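(* Let $h,G,R,\rho,C,L,\tau,u^0,(u^k)_{k\ge 0}$ be as described in the context, so that the basic assumptions, Assumptions A and Assumptions B all hold, and put $z^k:=\rho(u^k)$. Then the sequence $z^k$ either has finite length, $\sum_{k=1}^{\infty}\|z^{k+1}-z^k\|<\infty$, and converges to a limit $z^*\in\operatorname{int}\operatorname{dom}h$, or can be terminated after a finite number of steps.
   Context: Notation. $\overline{\mathbb R}=\mathbb R\cup\{+\infty\}$; for $f:\mathbb R^d\to\overline{\mathbb R}$, $\operatorname{dom}f=\{x: f(x)<\infty\}$; $f$ is proper if $\operatorname{dom}f\ne\emptyset$; $f$ is lower semi-continuous if $\liminf_{x\to\bar x}f(x)\ge f(\bar x)$ for all $\bar x\in\operatorname{dom}f$. $\operatorname{dist}(u,S)=\inf_{x\in S}\|u-x\|$. A proper convex function $h$ is essentially smooth if its convex subdifferential $\partial h$ is locally bounded and single-valued on its domain, or equivalently if $\operatorname{dom}\partial h=\operatorname{int}\operatorname{dom}h\neq\emptyset$. Basic assumptions. $C\subset\mathbb R^m$ is closed and convex with $\operatorname{int}C\ne\emptyset$. $h:\mathbb R^m\to\overline{\mathbb R}$ is proper, lower semi-continuous, convex, essentially smooth, with $\overline{\operatorname{dom}h}=C$. $G:\mathbb R^m\to\overline{\mathbb R}$ is proper, lower semi-continuous, $\operatorname{dom}h\subset\operatorname{dom}G$, and $G$ is differentiable on $\operatorname{int}\operatorname{dom}h$. $R:\mathbb R^n\to\overline{\mathbb R}$ is proper, lower semi-continuous and $\operatorname{dom}R\cap\rho^{-1}(\operatorname{int}\operatorname{dom}h)\neq\emptyset$.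 $\rho:\mathbb R^n\to\mathbb R^m$ is continuous. The objective is $E(u)=G(\rho(u))+R(u)$, to be minimized over $\Delta=\rho^{-1}(C)$. Bregman distance: $D_h(x,y)=h(x)-h(y)-\langle\nabla h(y),x-y\rangle$ for $x\in\mathbb R^m$, $y\in\operatorname{int}\operatorname{dom}h$ (and $D_h(x,y)=\infty$ if $y\notin\operatorname{int}\operatorname{dom}h$). For a step size $\tau>0$ and a point $u^k$ with $\rho(u^k)\in\operatorname{int}\operatorname{dom}h$, $$E_{u^k}(u)=\tfrac1\tau D_h(\rho(u),\rho(u^k))+G(\rho(u^k))+\langle\nabla G(\rho(u^k)),\rho(u)-\rho(u^k)\rangle+R(u).$$ The algorithm starts from a vector $u^0\in\rho^{-1}(\operatorname{int}\operatorname{dom}h)$ and obtains $u^{k+1}$ from the subproblem of minimizing $E_{u^k}$, the required accuracy of the solution being only what is specified in Assumptions A and B. Assumptions A. The basic assumptions hold; $E$ is bounded from below; $E$ is coercive; $L>0$ and $Lh-G$ is convex on $\operatorname{int}\operatorname{dom}h$; every iteration is solved sufficiently, so that $E_{u^k}(u^{k+1})\le E_{u^k}(u^k)=E(u^k)$ and $u^{k+1}\in\rho^{-1}(\operatorname{int}\operatorname{dom}h)$. Subdifferentials. For $f:\mathbb R^n\to\overline{\mathbb R}$ and $\bar u\in\operatorname{dom}f$, $v\in\hat\partial f(\bar u)$ iff $\liminf_{u\to\bar u,u\ne\bar u}\frac{f(u)-f(\bar u)-\langle v,u-\bar u\rangle}{\|u-\bar u\|}\ge0$; $v\in\partial f(\bar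 u)$ (limiting subgradient) iff there are $u^i\to\bar u$ with $f(u^i)\to f(\bar u)$ and $v^i\in\hat\partial f(u^i)$ with $v^i\to v$. Kurdyka-Łojasiewicz (KŁ) property of $E$ at $\bar u\in\operatorname{dom}E$: there exist $\eta>0$, $\varphi\in C^0[0,\eta)\cap C^1(0,\eta)$ with $\varphi(0)=0$, $\varphi$ concave, $\varphi'>0$, and a neighborhood $U$ of $\bar u$ such that $\varphi'(E(u)-E(\bar u))\operatorname{dist}(0,\partial E(u))\ge1$ for all $u\in U$ with $E(\bar u)<E(u)<E(\bar u)+\eta$. $\operatorname{accum}(u^0)$ is the set of all limits of convergent subsequences of $(u^k)$. Assumptions B. $E$ is continuous on its domain and satisfies the KŁ property at every point of $\operatorname{accum}(u^0)$; $h$ is strongly convex on $\operatorname{int}\operatorname{dom}h$ (with some modulus $>0$); $\rho$ is continuously differentiable; $\frac1\tau\nabla h-\nabla G$ is locally Lipschitz continuous on $\operatorname{int}\operatorname{dom}h$; with $Z=(z^k)_{k=1}^\infty$, the closure $\overline Z$ is contained in $\operatorname{int}\operatorname{dom}h$; every iteration satisfies $0\in\partial E_{u^k}(u^{k+1})$ and uses a step size $\tau<\frac1L$. *)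

theory Defs
  imports "HOL-Analysis.Analysis"
begin

text \<open>Functions with values in the reals extended by plus infinity are modelled by type
  \<^typ>\<open>ereal\<close>; the value minus infinity is excluded by properness.\<close>

definition edom :: "('a \<Rightarrow> ereal) \<Rightarrow> 'a set" where
  "edom f = {x. f x < \<infinity>}"

definition proper_fun :: "('a \<Rightarrow> ereal) \<Rightarrow> bool" where
  "proper_fun f \<longleftrightarrow> (\<forall>x. f x \<noteq> - \<infinity>) \<and> edom f \<noteq> {}"

text \<open>Lower semi-continuity is required only at points of the domain.\<close>

definition lsc_fun :: "('a::topological_space \<Rightarrow> ereal) \<Rightarrow> bool" where
  "lsc_fun f \<longleftrightarrow> (\<forall>x\<in>edom f. f x \<le> Liminf (at x) f)"

definition econvex :: "('a::real_vector \<Rightarrow> ereal) \<Rightarrow> bool" where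
  "econvex f \<longleftrightarrow> (\<forall>x y. \<forall>s\<ge>0. \<forall>t\<ge>0. s + t = 1 \<longrightarrow>
     f (s *\<^sub>R x + t *\<^sub>R y) \<le> ereal s * f x + ereal t * f y)"

definition convex_subdiff :: "('a::real_inner \<Rightarrow> ereal) \<Rightarrow> 'a \<Rightarrow> 'a set" where
  "convex_subdiff f x =
     (if x \<in> edom f then {g. \<forall>y. f x + ereal (inner g (y - x)) \<le> f y} else {})"

text \<open>The subdifferential is single-valued and locally bounded at every point where it is nonempty.\<close>

definition essentially_smooth :: "('a::real_inner \<Rightarrow> ereal) \<Rightarrow> bool" where
  "essentially_smooth f \<longleftrightarrow>
     (\<forall>x. convex_subdiff f x \<noteq> {} \<longrightarrow>
        (\<exists>g. convex_subdiff f x = {g}) \<and>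
        (\<exists>U. open U \<and> x \<in> U \<and> bounded (\<Union>y\<in>U. convex_subdiff f y)))"

definition strongly_convex_on :: "'a::real_inner set \<Rightarrow> real \<Rightarrow> ('a \<Rightarrow> real) \<Rightarrow> bool" where
  "strongly_convex_on S \<sigma> f \<longleftrightarrow> convex S \<and>
     (\<forall>x\<in>S. \<forall>y\<in>S. \<forall>s\<ge>0. \<forall>t\<ge>0. s + t = 1 \<longrightarrow>
        f (s *\<^sub>R x + t *\<^sub>R y) \<le> s * f x + t * f y - \<sigma> / 2 * s * t * (norm (x - y))\<^sup>2)"

definition locally_lipschitz_on ::
    "'a::metric_space set \<Rightarrow> ('a \<Rightarrow> 'b::metric_space) \<Rightarrow> bool" where
  "locally_lipschitz_on S f \<longleftrightarrow>
     (\<forall>x\<in>S. \<exists>r>0. \<exists>K. K-lipschitz_on (ball x r \<inter> S) f)"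

definition continuously_differentiable ::
    "('a::real_normed_vector \<Rightarrow> 'b::real_normed_vector) \<Rightarrow> bool" where
  "continuously_differentiable f \<longleftrightarrow>
     (\<exists>f' :: 'a \<Rightarrow> 'a \<Rightarrow>\<^sub>L 'b.
        (\<forall>x. (f has_derivative blinfun_apply (f' x)) (at x)) \<and> continuous_on UNIV f')"

text \<open>Meaningful only where the function is finite near the point and differentiable there.\<close>

definition egrad :: "('a::real_inner \<Rightarrow> ereal) \<Rightarrow> 'a \<Rightarrow> 'a" where
  "egrad f x = (THE g. GDERIV (\<lambda>y. real_of_ereal (f y)) x :> g)"

definition bregman :: "('a::real_inner \<Rightarrow> ereal) \<Rightarrow> 'a \<Rightarrow> 'a \<Rightarrow> ereal" where
  "bregman h x y =
     (if y \<in> interior (edom h) then h x - h y - ereal (inner (egrad h y) (x - y)) else \<infinity>)"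

definition objective ::
    "('b \<Rightarrow> ereal) \<Rightarrow> ('a \<Rightarrow> ereal) \<Rightarrow> ('a \<Rightarrow> 'b) \<Rightarrow> 'a \<Rightarrow> ereal" where
  "objective G R \<rho> u = G (\<rho> u) + R u"

text \<open>\<open>surrogate h G R \<rho> \<tau> w\<close> is the majorizing function built at the point \<open>w\<close>.\<close>

definition surrogate ::
    "('b::real_inner \<Rightarrow> ereal) \<Rightarrow> ('b \<Rightarrow> ereal) \<Rightarrow> ('a \<Rightarrow> ereal) \<Rightarrow> ('a \<Rightarrow> 'b) \<Rightarrow> real \<Rightarrow>
     'a \<Rightarrow> 'a \<Rightarrow> ereal" where
  "surrogate h G R \<rho> \<tau> w u =
     ereal (1 / \<tau>) * bregman h (\<rho> u) (\<rho> w) + G (\<rho> w)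
       + ereal (inner (egrad G (\<rho> w)) (\<rho> u - \<rho> w)) + R u"

lemma surrogate_self:
  assumes "proper_fun h" and "\<rho> w \<in> interior (edom h)"
  shows "surrogate h G R \<rho> \<tau> w w = objective G R \<rho> w"
proof -
  have "h (\<rho> w) \<noteq> \<infinity>" "h (\<rho> w) \<noteq> - \<infinity>"
    using assms interior_subset[of "edom h"] by (auto simp: proper_fun_def edom_def)
  then have "bregman h (\<rho> w) (\<rho> w) = 0"
    using assms(2) by (cases "h (\<rho> w)") (auto simp: bregman_def zero_ereal_def)
  then show ?thesis
    by (simp add: surrogate_def objective_def flip: zero_ereal_def)
qed

definition frechet_subdiff :: "('a::real_inner \<Rightarrow> ereal) \<Rightarrow> 'a \<Rightarrow> 'a set" where
  "frechet_subdiff f x =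
     (if x \<in> edom f
      then {v. 0 \<le> Liminf (at x) (\<lambda>y. (f y - f x - ereal (inner v (y - x))) / ereal (norm (y - x)))}
      else {})"

definition limiting_subdiff :: "('a::real_inner \<Rightarrow> ereal) \<Rightarrow> 'a \<Rightarrow> 'a set" where
  "limiting_subdiff f x =
     (if x \<in> edom f
      then {v. \<exists>y w. y \<longlonglongrightarrow> x \<and> (\<lambda>i::nat. f (y i)) \<longlonglongrightarrow> f x
                  \<and> (\<forall>i. w i \<in> frechet_subdiff f (y i)) \<and> w \<longlonglongrightarrow> v}
      else {})"

text \<open>The library's \<^const>\<open>infdist\<close> gives distance 0 to the empty set; here it must be infinite.\<close>

definition edist_set :: "'a::real_normed_vector \<Rightarrow> 'a set \<Rightarrow> ereal" where
  "edist_set u S = (INF x\<in>S. ereal (norm (u - x)))"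

definition KL_property :: "('a::real_inner \<Rightarrow> ereal) \<Rightarrow> 'a \<Rightarrow> bool" where
  "KL_property f x \<longleftrightarrow> x \<in> edom f \<and>
     (\<exists>\<eta>>0. \<exists>(\<phi>::real \<Rightarrow> real) \<phi>' U.
        continuous_on {0..<\<eta>} \<phi> \<and> \<phi> 0 = 0 \<and> concave_on {0..<\<eta>} \<phi> \<and>
        (\<forall>s\<in>{0<..<\<eta>}. (\<phi> has_real_derivative \<phi>' s) (at s) \<and> \<phi>' s > 0) \<and>
        continuous_on {0<..<\<eta>} \<phi>' \<and>
        open U \<and> x \<in> U \<and>
        (\<forall>u\<in>U. f x < f u \<and> f u < f x + ereal \<eta> \<longrightarrow>
           ereal (\<phi>' (real_of_ereal (f u - f x))) * edist_set 0 (limiting_subdiff f u) \<ge> 1))"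

definition accum_points :: "(nat \<Rightarrow> 'a::topological_space) \<Rightarrow> 'a set" where
  "accum_points u = {x. \<exists>r::nat \<Rightarrow> nat. strict_mono r \<and> (u \<circ> r) \<longlonglongrightarrow> x}"

text \<open>From step \<open>K\<close> on the images under \<open>\<rho>\<close> no longer change, and \<open>u K\<close> is a critical
  point of \<open>E\<close>, so that stopping there is justified.\<close>

definition terminates_finitely ::
    "('a::real_inner \<Rightarrow> ereal) \<Rightarrow> ('a \<Rightarrow> 'b) \<Rightarrow> (nat \<Rightarrow> 'a) \<Rightarrow> bool" where
  "terminates_finitely E \<rho> u \<longleftrightarrow>
     (\<exists>K. 0 \<in> limiting_subdiff E (u K) \<and> (\<forall>k\<ge>K. \<rho> (u k) = \<rho> (u K)))"

end

theory Submission
  imports Defs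
begin

text \<open>The surrogate at \<open>u k\<close> exceeds the objective by the Bregman distance of
  \<open>H = h / \<tau> - G\<close>, which is strongly convex since \<open>\<tau> < 1 / L\<close>. Hence each step decreases the
  objective by a multiple of \<open>(norm (z (Suc k) - z k))\<^sup>2\<close>, and removing the smooth gap from
  the criticality condition leaves a limiting subgradient of the objective at \<open>u (Suc k)\<close> of norm at
  most a multiple of \<open>norm (z (Suc k) - z k)\<close>. The points \<open>u k\<close> need not converge, so the
  Kurdyka-Lojasiewicz inequality is applied near the whole set of accumulation points: finitely many
  neighbourhoods cover the tail of the sequence, and the sum of the corresponding desingularizing
  functions serves as a potential. If the objective reaches its limit value after finitely many
  steps, the decrease makes \<open>z\<close> stationary and the subgradient zero.\<close>

section \<open>Convexity, subgradients and gradients of extended-valued functions\<close>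

lemma edom_real:
  assumes "proper_fun f" "x \<in> edom f"
  shows "f x = ereal (real_of_ereal (f x))"
  using assms by (cases "f x") (auto simp: proper_fun_def edom_def)

lemma econvex_imp_convex_on:
  assumes "proper_fun h" "econvex h"
  shows "convex_on (edom h) (\<lambda>x. real_of_ereal (h x))"
proof -
  have comb: "h (s *\<^sub>R x + t *\<^sub>R y) \<le> ereal (s * real_of_ereal (h x) + t * real_of_ereal (h y))"
    if "x \<in> edom h" "y \<in> edom h" "0 \<le> s" "0 \<le> t" "s + t = 1" for x y s t
  proof -
    have "h (s *\<^sub>R x + t *\<^sub>R y) \<le> ereal s * h x + ereal t * h y"
      using assms(2) that by (auto simp: econvex_def)
    also have "\<dots> = ereal s * ereal (real_of_ereal (h x)) + ereal t * ereal (real_of_ereal (h y))"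
      using edom_real[OF assms(1)] that by metis
    finally show ?thesis by simp
  qed
  have cvx: "convex (edom h)"
    unfolding convex_def
  proof (intro ballI allI impI)
    fix x y and s t :: real
    assume *: "x \<in> edom h" "y \<in> edom h" "0 \<le> s" "0 \<le> t" "s + t = 1"
    from comb[OF this] show "s *\<^sub>R x + t *\<^sub>R y \<in> edom h"
      by (auto simp: edom_def intro: le_less_trans)
  qed
  show ?thesis
    unfolding convex_on_def
  proof (intro conjI ballI allI impI cvx)
    fix x y and s t :: real
    assume *: "x \<in> edom h" "y \<in> edom h" "0 \<le> s" "0 \<le> t" "s + t = 1"
    have "s *\<^sub>R x + t *\<^sub>R y \<in> edom h"
      using cvx * by (auto simp: convex_def)
    then have "ereal (real_of_ereal (h (s *\<^sub>R x + t *\<^sub>R y)))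
        \<le> ereal (s * real_of_ereal (h x) + t * real_of_ereal (h y))"
      using comb[OF *] edom_real[OF assms(1)] by metis
    then show "real_of_ereal (h (s *\<^sub>R x + t *\<^sub>R y))
        \<le> s * real_of_ereal (h x) + t * real_of_ereal (h y)"
      by simp
  qed
qed

text \<open>A hyperplane separates the epigraph from the vertical ray strictly below the graph point
  over \<open>x\<close>. Interiority of \<open>x\<close> rules out a vertical hyperplane, so its
  slope is a subgradient.\<close>

lemma convex_subdiff_nonempty:
  fixes h :: "'a::euclidean_space \<Rightarrow> ereal"
  assumes "proper_fun h" "econvex h" and x: "x \<in> interior (edom h)"
  shows "convex_subdiff h x \<noteq> {}"
proof -
  define f where "f = (\<lambda>x. real_of_ereal (h x))"
  have f: "h y = ereal (f y)" if "y \<in> edom h" for y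
    using edom_real[OF assms(1) that] by (simp add: f_def)
  have cvx: "convex_on (edom h) f"
    using econvex_imp_convex_on[OF assms(1,2)] by (simp add: f_def)
  then have "convex (edom h)"
    by (simp add: convex_on_def)
  have xd: "x \<in> edom h"
    using x interior_subset by blast
  define T where "T = epigraph (edom h) f"
  define B where "B = {x} \<times> {..<f x}"
  have "convex T" "convex B"
    using cvx \<open>convex (edom h)\<close> by (auto simp: T_def B_def convex_epigraph intro: convex_Times)
  moreover have "T \<noteq> {}" "B \<noteq> {}"
    using xd by (auto simp: T_def B_def epigraph_def)
  moreover have "B \<inter> T = {}"
    by (auto simp: T_def B_def epigraph_def)
  ultimately obtain p c where p: "p \<noteq> 0"
      and le: "\<And>q. q \<in> B \<Longrightarrow> inner p q \<le> c" and ge: "\<And>q. q \<in> T \<Longrightarrow> c \<le> inner p q"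
    using separating_hyperplane_sets[of B T] by metis
  obtain a \<alpha> where pa: "p = (a, \<alpha>)" by (cases p)
  have below: "inner a x + \<alpha> * r \<le> c" if "r < f x" for r
    using le[of "(x, r)"] that by (simp add: B_def pa)
  have above: "c \<le> inner a y + \<alpha> * r" if "y \<in> edom h" "f y \<le> r" for y r
    using ge[of "(y, r)"] that by (simp add: T_def epigraph_def pa)
  have "\<alpha> \<ge> 0"
    using below[of "f x - 1"] above[of x "f x"] xd by (auto simp: algebra_simps)
  \<comment> \<open>If the hyperplane were vertical, moving from \<open>x\<close> against
    \<open>a\<close> by \<open>e / 2\<close> would stay in the domain but cross to the wrong
    side.\<close>
  moreover have "\<alpha> \<noteq> 0"
  proof
    assume "\<alpha> = 0"
    obtain e where e: "e > 0" "ball x e \<subseteq> edom h"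
      using x by (meson mem_interior)
    have "a \<noteq> 0" using p pa \<open>\<alpha> = 0\<close> by (auto simp: zero_prod_def)
    define y where "y = x - (e / (2 * norm a)) *\<^sub>R a"
    have "y \<in> ball x e"
      using e \<open>a \<noteq> 0\<close> by (simp add: y_def dist_norm)
    then have "c \<le> inner a y"
      using above[of y "f y"] e \<open>\<alpha> = 0\<close> by auto
    moreover have "inner a x \<le> c"
      using below[of "f x - 1"] \<open>\<alpha> = 0\<close> by simp
    ultimately have "(e / (2 * norm a)) * inner a a \<le> 0"
      by (simp add: y_def inner_diff_right)
    moreover have "(e / (2 * norm a)) * inner a a > 0"
      using e \<open>a \<noteq> 0\<close> by simp
    ultimately show False by linarith
  qed
  ultimately have \<alpha>: "\<alpha> > 0" by simp
  \<comment> \<open>The ray omits its endpoint \<open>f x\<close>, which is reached in the limit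
    through heights \<open>f x - e / \<alpha>\<close>.\<close>
  have "inner a x + \<alpha> * f x \<le> c"
  proof (rule field_le_epsilon)
    fix e :: real assume "e > 0"
    then show "inner a x + \<alpha> * f x \<le> c + e"
      using below[of "f x - e / \<alpha>"] \<alpha> by (simp add: algebra_simps)
  qed
  have "h x + ereal (inner (- (1 / \<alpha>) *\<^sub>R a) (y - x)) \<le> h y" for y
  proof (cases "y \<in> edom h")
    case True
    have "inner a x + \<alpha> * f x \<le> inner a y + \<alpha> * f y"
      using \<open>inner a x + \<alpha> * f x \<le> c\<close> above[OF True order_refl] by linarith
    then have "f x + inner (- (1 / \<alpha>) *\<^sub>R a) (y - x) \<le> f y"
      using \<alpha> by (simp add: inner_diff_right field_simps)
    then show ?thesis
      using f[OF True] f[OF xd] by simp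
  qed (auto simp: edom_def)
  then have "- (1 / \<alpha>) *\<^sub>R a \<in> convex_subdiff h x"
    using xd by (simp only: convex_subdiff_def if_True mem_Collect_eq simp_thms)
  then show ?thesis by blast
qed

text \<open>Subgradients near \<open>x\<close> are bounded and their limits are subgradients at
  \<open>x\<close>, where only \<open>g\<close> exists. Hence they converge to \<open>g\<close>, and
  this continuity upgrades the unique subgradient to a gradient.\<close>

lemma essentially_smooth_gderiv:
  fixes h :: "'a::euclidean_space \<Rightarrow> ereal"
  assumes h: "proper_fun h" "econvex h" "essentially_smooth h" and x: "x \<in> interior (edom h)"
  shows "\<exists>g. GDERIV (\<lambda>y. real_of_ereal (h y)) x :> g"
proof -
  let ?S = "interior (edom h)"
  define f where "f = (\<lambda>x. real_of_ereal (h x))"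
  have fd: "h y = ereal (f y)" if "y \<in> edom h" for y
    using edom_real[OF h(1) that] by (simp add: f_def)
  have f: "h y = ereal (f y)" if "y \<in> ?S" for y
    using fd that interior_subset[of "edom h"] by blast
  have "convex_on ?S f"
  proof (rule convex_on_subset)
    show "convex_on (edom h) f"
      using econvex_imp_convex_on[OF h(1,2)] by (simp add: f_def)
    then show "convex ?S"
      by (intro convex_interior) (rule convex_on_imp_convex)
  qed (rule interior_subset)
  then have cont: "continuous_on ?S f"
    by (intro convex_on_continuous) auto
  obtain g U where g: "convex_subdiff h x = {g}" and U: "open U" "x \<in> U"
      "bounded (\<Union>y\<in>U. convex_subdiff h y)"
    using h(3) convex_subdiff_nonempty[OF h(1,2) x] unfolding essentially_smooth_def by blast
  have sub: "f y + inner v (w - y) \<le> f w" if "v \<in> convex_subdiff h y" "y \<in> ?S" "w \<in> ?S" for v y w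
  proof -
    have "h y + ereal (inner v (w - y)) \<le> h w"
      using that(1) by (auto simp: convex_subdiff_def split: if_splits)
    then show ?thesis
      using f that by simp
  qed
  \<comment> \<open>Otherwise some subgradients at points \<open>y n\<close> tending to
    \<open>x\<close> stay \<open>e\<close> away from \<open>g\<close>; local boundedness yields a
    convergent subsequence whose limit \<open>l\<close> must be \<open>g\<close>.\<close>
  have near: "\<exists>d>0. \<forall>y v. dist y x < d \<longrightarrow> v \<in> convex_subdiff h y \<longrightarrow> norm (v - g) \<le> e"
    if "e > 0" for e
  proof (rule ccontr)
    assume neg: "\<not> ?thesis"
    have "\<forall>n. \<exists>y v. dist y x < inverse (Suc n) \<and> v \<in> convex_subdiff h y \<and> norm (v - g) > e"
    proof
      fix n :: nat
      have "inverse (real (Suc n)) > 0" by simp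
      with neg show "\<exists>y v. dist y x < inverse (Suc n) \<and> v \<in> convex_subdiff h y \<and> norm (v - g) > e"
        unfolding not_le[symmetric] by blast
    qed
    then obtain y v where yv: "\<And>n. dist (y n) x < inverse (Suc n)"
        "\<And>n. v n \<in> convex_subdiff h (y n)" "\<And>n. norm (v n - g) > e"
      by metis
    have y: "y \<longlonglongrightarrow> x"
      by (rule metric_tendsto_imp_tendsto[OF LIMSEQ_inverse_real_of_nat])
        (use less_imp_le[OF yv(1)] in \<open>auto simp: dist_real_def\<close>)
    \<comment> \<open>\<open>U\<close> supplies the bound on the subgradients, \<open>?S\<close> the
      finiteness and continuity of \<open>f\<close> along the tail.\<close>
    have "eventually (\<lambda>n. y n \<in> U \<inter> ?S) sequentially"
      using topological_tendstoD[OF y, of "U \<inter> ?S"] U x by auto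
    then obtain N where N: "\<And>n. n \<ge> N \<Longrightarrow> y n \<in> U \<inter> ?S"
      by (auto simp: eventually_sequentially)
    have "bounded (range (\<lambda>n. v (n + N)))"
      by (rule bounded_subset[OF U(3)]) (use N yv(2) in fastforce)
    then obtain l r where r: "strict_mono r" "((\<lambda>n. v (n + N)) \<circ> r) \<longlonglongrightarrow> l"
      using bounded_imp_convergent_subsequence by blast
    define k where "k n = r n + N" for n
    have kN: "k n \<ge> N" for n by (simp add: k_def)
    have vk: "(\<lambda>n. v (k n)) \<longlonglongrightarrow> l"
      using r(2) by (simp add: k_def o_def)
    have "strict_mono k"
      using r(1) by (simp add: k_def strict_mono_def)
    then have yk: "(\<lambda>n. y (k n)) \<longlonglongrightarrow> x"
      using LIMSEQ_subseq_LIMSEQ[OF y] by (simp add: o_def)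
    have "isCont f x"
      using cont x by (simp add: continuous_on_eq_continuous_at)
    then have fyk: "(\<lambda>n. f (y (k n))) \<longlonglongrightarrow> f x"
      using yk by (rule isCont_tendsto_compose)
    have "h x + ereal (inner l (w - x)) \<le> h w" for w
    proof (cases "w \<in> edom h")
      case True
      have "f (y (k n)) + inner (v (k n)) (w - y (k n)) \<le> f w" for n
      proof -
        have "h (y (k n)) + ereal (inner (v (k n)) (w - y (k n))) \<le> h w"
          using yv(2)[of "k n"] by (auto simp: convex_subdiff_def split: if_splits)
        then show ?thesis
          using f[of "y (k n)"] N[OF kN] fd[OF True] by simp
      qed
      moreover have "(\<lambda>n. f (y (k n)) + inner (v (k n)) (w - y (k n))) \<longlonglongrightarrow> f x + inner l (w - x)"
        by (intro tendsto_intros fyk vk yk)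
      ultimately have "f x + inner l (w - x) \<le> f w"
        by (intro LIMSEQ_le_const2) auto
      then show ?thesis
        using f[OF x] fd[OF True] by simp
    qed (auto simp: edom_def)
    then have "l \<in> convex_subdiff h x"
      using x interior_subset by (auto simp: convex_subdiff_def)
    then have "l = g" using g by simp
    have "(\<lambda>n. norm (v (k n) - g)) \<longlonglongrightarrow> norm (l - g)"
      by (intro tendsto_intros vk)
    then have "e \<le> norm (l - g)"
      using yv(3) by (intro LIMSEQ_le_const) (auto intro: less_imp_le)
    then show False using \<open>l = g\<close> that by simp
  qed
  have "(f has_derivative (\<lambda>d. inner d g)) (at x)"
    unfolding has_derivative_at_alt
  proof (intro conjI allI impI bounded_linear_inner_left)
    fix e :: real assume "e > 0"
    obtain d where d: "d > 0" "\<And>y v. dist y x < d \<Longrightarrow> v \<in> convex_subdiff h y \<Longrightarrow> norm (v - g) \<le> e"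
      using near[OF \<open>e > 0\<close>] by blast
    obtain d' where d': "d' > 0" "ball x d' \<subseteq> ?S"
      using x open_contains_ball by blast
    have "norm (f y - f x - inner (y - x) g) \<le> e * norm (y - x)"
      if "norm (y - x) < min d d'" for y
    proof -
      have y: "y \<in> ?S"
        using d' that by (auto simp: dist_norm norm_minus_commute)
      then obtain v where v: "v \<in> convex_subdiff h y"
        using convex_subdiff_nonempty[OF h(1,2)] by blast
      have "norm (v - g) \<le> e"
        using d(2)[OF _ v] that by (simp add: dist_norm)
      \<comment> \<open>The linearization error is nonnegative by the subgradient inequality at
        \<open>x\<close> and at most \<open>inner (v - g) (y - x)\<close> by the one at
        \<open>y\<close>.\<close>
      then have "inner (v - g) (y - x) \<le> e * norm (y - x)"
        by (meson mult_right_mono norm_cauchy_schwarz norm_ge_zero order_trans)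
      moreover have "f x + inner g (y - x) \<le> f y"
        using sub[of g x y] g x y by simp
      moreover have "f y + inner v (x - y) \<le> f x"
        using sub[OF v y x] by simp
      ultimately show ?thesis
        by (simp add: inner_diff_left inner_diff_right inner_commute)
    qed
    then show "\<exists>d>0. \<forall>y. norm (y - x) < d \<longrightarrow> norm (f y - f x - inner (y - x) g) \<le> e * norm (y - x)"
      using d(1) d'(1) by (intro exI[of _ "min d d'"]) auto
  qed
  then show ?thesis
    unfolding gderiv_def f_def by blast
qed

text \<open>The Riesz representation with an explicit coordinate formula, which later makes
  continuity of a gradient field a matter of continuity of its coordinates.\<close>

lemma linear_functional_eq_inner:
  fixes f :: "'a::euclidean_space \<Rightarrow> real"
  assumes "linear f"
  shows "f d = inner d (\<Sum>b\<in>Basis. f b *\<^sub>R b)"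
proof -
  have "f d = f (\<Sum>b\<in>Basis. inner d b *\<^sub>R b)"
    by (simp add: euclidean_representation)
  also have "\<dots> = (\<Sum>b\<in>Basis. inner d b * f b)"
    using assms by (simp add: linear_sum linear_scale)
  finally show ?thesis
    by (simp add: inner_sum_right mult.commute)
qed

lemma differentiable_imp_gderiv:
  fixes f :: "'a::euclidean_space \<Rightarrow> real"
  assumes "f differentiable (at x)"
  shows "\<exists>g. GDERIV f x :> g"
proof -
  obtain f' where f': "(f has_derivative f') (at x)"
    using assms by (auto simp: differentiable_def)
  then have "f' = (\<lambda>d. inner d (\<Sum>b\<in>Basis. f' b *\<^sub>R b))"
    using linear_functional_eq_inner has_derivative_linear by blast
  with f' show ?thesis
    unfolding gderiv_def by metis
qed

lemma gderiv_unique: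
  assumes "GDERIV f x :> a" "GDERIV f x :> b"
  shows "a = b"
proof -
  have "(\<lambda>d. inner d a) = (\<lambda>d. inner d b)"
    using assms has_derivative_unique unfolding gderiv_def by blast
  then have "inner (a - b) (a - b) = 0"
    by (metis inner_diff_right right_minus_eq)
  then show ?thesis by simp
qed

lemma gderiv_egrad:
  assumes "GDERIV (\<lambda>y. real_of_ereal (f y)) x :> g"
  shows "GDERIV (\<lambda>y. real_of_ereal (f y)) x :> egrad f x"
proof -
  have "egrad f x = g"
    unfolding egrad_def using assms gderiv_unique by blast
  with assms show ?thesis by simp
qed

text \<open>Dividing the strong convexity inequality on the segment from \<open>y\<close> to
  \<open>x\<close> by \<open>t\<close> and letting \<open>t\<close> decrease to 0 turns the quotient
  into the directional derivative; the factor \<open>1 - t\<close> tends to 1, so the full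
  \<open>\<sigma> / 2\<close> survives.\<close>

lemma strongly_convex_on_gderiv:
  fixes f :: "'a::real_inner \<Rightarrow> real"
  assumes f: "strongly_convex_on S \<sigma> f" and x: "x \<in> S" and y: "y \<in> S" and g: "GDERIV f y :> g"
  shows "f y + inner g (x - y) + \<sigma> / 2 * (norm (x - y))\<^sup>2 \<le> f x"
proof -
  define q where "q t = y + t *\<^sub>R (x - y)" for t :: real
  have "(q has_vector_derivative (x - y)) (at 0)"
    unfolding q_def by (auto intro!: derivative_eq_intros)
  moreover have "(f has_derivative (\<lambda>d. inner d g)) (at (q 0))"
    using g by (simp add: gderiv_def q_def)
  ultimately have "((f \<circ> q) has_derivative (\<lambda>t. inner (t *\<^sub>R (x - y)) g)) (at 0)"
    using diff_chain_at unfolding has_vector_derivative_def o_def by blast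
  then have "((f \<circ> q) has_real_derivative inner (x - y) g) (at 0)"
    by (simp add: has_field_derivative_def mult.commute[of _ "inner _ _"])
  then have "((\<lambda>t. (f (q t) - f y) / t) \<longlongrightarrow> inner g (x - y)) (at_right 0)"
    by (simp add: has_field_derivative_iff q_def inner_commute filterlim_at_split)
  moreover have "((\<lambda>t. f x - f y - \<sigma> / 2 * (1 - t) * (norm (x - y))\<^sup>2)
      \<longlongrightarrow> f x - f y - \<sigma> / 2 * (1 - 0) * (norm (x - y))\<^sup>2) (at_right 0)"
    by (intro tendsto_intros)
  moreover have "eventually (\<lambda>t. (f (q t) - f y) / t \<le> f x - f y - \<sigma> / 2 * (1 - t) * (norm (x - y))\<^sup>2)
      (at_right 0)"
    unfolding eventually_at_right_field
  proof (intro exI[of _ "1::real"] conjI allI impI zero_less_one)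
    fix t :: real assume t: "0 < t" "t < 1"
    have "q t = t *\<^sub>R x + (1 - t) *\<^sub>R y"
      by (simp add: q_def algebra_simps)
    moreover have "f (t *\<^sub>R x + (1 - t) *\<^sub>R y)
        \<le> t * f x + (1 - t) * f y - \<sigma> / 2 * t * (1 - t) * (norm (x - y))\<^sup>2"
      using f x y t by (simp add: strongly_convex_on_def)
    ultimately have "f (q t) - f y \<le> t * (f x - f y - \<sigma> / 2 * (1 - t) * (norm (x - y))\<^sup>2)"
      by (simp only:) (simp add: algebra_simps)
    then show "(f (q t) - f y) / t \<le> f x - f y - \<sigma> / 2 * (1 - t) * (norm (x - y))\<^sup>2"
      using t by (simp add: pos_divide_le_eq mult.commute)
  qed
  ultimately have "inner g (x - y) \<le> f x - f y - \<sigma> / 2 * (1 - 0) * (norm (x - y))\<^sup>2"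
    by (intro tendsto_le[OF trivial_limit_at_right_real])
  then show ?thesis by simp
qed

section \<open>Frechet and limiting subgradients under smooth perturbations\<close>

lemma frechet_subdiff_iff:
  assumes fx: "f x = ereal c"
  shows "v \<in> frechet_subdiff f x \<longleftrightarrow>
    (\<forall>e>0. \<forall>\<^sub>F y in at x. ereal (c + inner v (y - x) - e * norm (y - x)) \<le> f y)"
proof -
  define q where "q = (\<lambda>y. (f y - f x - ereal (inner v (y - x))) / ereal (norm (y - x)))"
  \<comment> \<open>Clearing the positive denominator is safe even where \<open>f y\<close> is
    infinite, since dividing by a positive real preserves the sign of infinity. Afterwards no
    extended-real quotient remains.\<close>
  have q: "ereal (- e) \<le> q y \<longleftrightarrow> ereal (c + inner v (y - x) - e * norm (y - x)) \<le> f y"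
    if "y \<noteq> x" for y e
  proof -
    have pos: "norm (y - x) > 0" using that by simp
    show ?thesis
    proof (cases "f y")
      case (real r)
      have "ereal (- e) \<le> q y \<longleftrightarrow> - e \<le> (r - c - inner v (y - x)) / norm (y - x)"
        using pos fx real by (simp add: q_def)
      also have "\<dots> \<longleftrightarrow> c + inner v (y - x) - e * norm (y - x) \<le> r"
        using pos by (auto simp: pos_le_divide_eq)
      finally show ?thesis using real by simp
    next
      case PInf
      then have "q y = \<infinity> / ereal (norm (y - x))"
        using fx by (simp add: q_def)
      then have "q y = \<infinity>"
        using pos by simp
      then show ?thesis using PInf by simp
    next
      case MInf
      then have "q y = - \<infinity> / ereal (norm (y - x))"
        using fx by (simp add: q_def)
      then have "q y = - \<infinity>"
        using pos by simp
      then show ?thesis using MInf by simp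
    qed
  qed
  have "v \<in> frechet_subdiff f x \<longleftrightarrow> 0 \<le> Liminf (at x) q"
    using fx by (simp add: frechet_subdiff_def edom_def q_def)
  also have "\<dots> \<longleftrightarrow> (\<forall>e>0. \<forall>\<^sub>F y in at x. ereal (- e) \<le> q y)"
  proof
    assume "0 \<le> Liminf (at x) q"
    show "\<forall>e>0. \<forall>\<^sub>F y in at x. ereal (- e) \<le> q y"
    proof (intro allI impI)
      fix e :: real assume "e > 0"
      then have "ereal (- e) < 0" by simp
      then have "\<forall>\<^sub>F y in at x. ereal (- e) < q y"
        using \<open>0 \<le> Liminf (at x) q\<close> by (simp add: le_Liminf_iff)
      then show "\<forall>\<^sub>F y in at x. ereal (- e) \<le> q y"
        by eventually_elim simp
    qed
  next
    assume *: "\<forall>e>0. \<forall>\<^sub>F y in at x. ereal (- e) \<le> q y"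
    show "0 \<le> Liminf (at x) q"
      unfolding le_Liminf_iff
    proof (intro allI impI)
      fix b :: ereal assume "b < 0"
      then obtain r where r: "b < ereal r" "ereal r < 0"
        using ereal_dense2 by blast
      then have "\<forall>\<^sub>F y in at x. ereal (- (- r)) \<le> q y"
        using * spec[OF *, of "- r"] by simp
      then show "\<forall>\<^sub>F y in at x. b < q y"
        by eventually_elim (use r(1) in auto)
    qed
  qed
  also have "\<dots> \<longleftrightarrow> (\<forall>e>0. \<forall>\<^sub>F y in at x. ereal (c + inner v (y - x) - e * norm (y - x)) \<le> f y)"
  proof -
    have "(\<forall>\<^sub>F y in at x. ereal (- e) \<le> q y) \<longleftrightarrow>
        (\<forall>\<^sub>F y in at x. ereal (c + inner v (y - x) - e * norm (y - x)) \<le> f y)" for e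
      unfolding eventually_at_filter using q by (intro eventually_subst always_eventually) auto
    then show ?thesis by simp
  qed
  finally show ?thesis .
qed

text \<open>The tolerance \<open>e\<close> is split in half between the subgradient inequality of
  \<open>f2\<close> and the first-order expansion of \<open>g\<close>.\<close>

lemma frechet_subdiff_add_gderiv:
  fixes g :: "'a::real_inner \<Rightarrow> real"
  assumes eq: "\<forall>\<^sub>F y in nhds x. f y = f2 y + ereal (g y)"
    and fin: "f2 x \<noteq> - \<infinity>" and g: "GDERIV g x :> a" and v: "v \<in> frechet_subdiff f2 x"
  shows "v + a \<in> frechet_subdiff f x"
proof -
  have "f2 x < \<infinity>"
    using v by (auto simp: frechet_subdiff_def edom_def split: if_splits)
  with fin obtain c where c: "f2 x = ereal c"
    by (cases "f2 x") auto
  have fx: "f x = ereal (c + g x)"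
    using eventually_nhds_x_imp_x[OF eq] c by simp
  show ?thesis
    unfolding frechet_subdiff_iff[of f, OF fx]
  proof (intro allI impI)
    fix e :: real assume "e > 0"
    have "(g has_derivative (\<lambda>d. inner d a)) (at x)"
      using g by (simp add: gderiv_def)
    moreover have "e / 2 > 0" using \<open>e > 0\<close> by simp
    ultimately obtain d where d: "d > 0"
        "\<And>y. norm (y - x) < d \<Longrightarrow> norm (g y - g x - inner (y - x) a) \<le> e / 2 * norm (y - x)"
      unfolding has_derivative_at_alt by blast
    have 1: "\<forall>\<^sub>F y in at x. dist y x < d"
      using d(1) eventually_at by blast
    have 2: "\<forall>\<^sub>F y in at x. ereal (c + inner v (y - x) - e / 2 * norm (y - x)) \<le> f2 y"
      using v \<open>e / 2 > 0\<close> unfolding frechet_subdiff_iff[of f2, OF c] by blast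
    have 3: "\<forall>\<^sub>F y in at x. f y = f2 y + ereal (g y)"
      using eq by (auto simp: eventually_at_filter elim: eventually_mono)
    from 1 2 3
    show "\<forall>\<^sub>F y in at x. ereal (c + g x + inner (v + a) (y - x) - e * norm (y - x)) \<le> f y"
    proof eventually_elim
      case (elim y)
      have "\<bar>g y - g x - inner (y - x) a\<bar> \<le> e / 2 * norm (y - x)"
        using d(2) elim(1) by (simp add: dist_norm)
      then have "g x + inner a (y - x) - e / 2 * norm (y - x) \<le> g y"
        unfolding inner_commute[of a] by linarith
      with elim(2,3) show ?case
        by (cases "f2 y") (simp_all add: inner_add_left)
    qed
  qed
qed

text \<open>The Frechet rule is applied along the approximating sequence, whose tail lies in
  \<open>V\<close>. Continuity of \<open>g\<close> keeps the function values convergent, and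
  continuity of \<open>D\<close> at \<open>x\<close> lets the shifted subgradients converge.\<close>

lemma limiting_subdiff_add_gderiv:
  fixes g :: "'a::real_inner \<Rightarrow> real"
  assumes V: "open V" "x \<in> V"
    and eq: "\<And>y. y \<in> V \<Longrightarrow> f y = f2 y + ereal (g y)"
    and fin: "\<And>y. y \<in> V \<Longrightarrow> f2 y \<noteq> - \<infinity>"
    and g: "\<And>y. y \<in> V \<Longrightarrow> GDERIV g y :> D y" and D: "isCont D x"
    and v: "v \<in> limiting_subdiff f2 x"
  shows "v + D x \<in> limiting_subdiff f x"
proof -
  obtain y w where y: "y \<longlonglongrightarrow> x" "(\<lambda>i. f2 (y i)) \<longlonglongrightarrow> f2 x"
      "\<And>i. w i \<in> frechet_subdiff f2 (y i)" "w \<longlonglongrightarrow> v" and xd: "x \<in> edom f2"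
    using v by (auto simp: limiting_subdiff_def split: if_splits)
  have "\<forall>\<^sub>F i in sequentially. y i \<in> V"
    using y(1) V topological_tendstoD by blast
  then obtain N where N: "\<And>i. i \<ge> N \<Longrightarrow> y i \<in> V"
    by (auto simp: eventually_sequentially)
  let ?y = "\<lambda>i. y (i + N)"
  have y': "?y \<longlonglongrightarrow> x" "(\<lambda>i. f2 (?y i)) \<longlonglongrightarrow> f2 x" "(\<lambda>i. w (i + N)) \<longlonglongrightarrow> v"
    using LIMSEQ_ignore_initial_segment y(1,2,4) by blast+
  have "isCont g x"
    using g[OF V(2)] unfolding gderiv_def by (rule has_derivative_continuous)
  then have "(\<lambda>i. ereal (g (?y i))) \<longlonglongrightarrow> ereal (g x)"
    using isCont_tendsto_compose[OF _ y'(1)] by simp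
  then have "(\<lambda>i. f2 (?y i) + ereal (g (?y i))) \<longlonglongrightarrow> f2 x + ereal (g x)"
    using xd fin[OF V(2)] y'(2) by (intro tendsto_add_ereal) (auto simp: edom_def)
  then have "(\<lambda>i. f (?y i)) \<longlonglongrightarrow> f x"
    using eq V(2) N by simp
  moreover have "w (i + N) + D (?y i) \<in> frechet_subdiff f (?y i)" for i
  proof (rule frechet_subdiff_add_gderiv)
    show "\<forall>\<^sub>F z in nhds (?y i). f z = f2 z + ereal (g z)"
      using eventually_nhds_in_open[OF V(1) N[of "i + N"]] eq by (auto elim: eventually_mono)
  qed (use fin g N y(3) in auto)
  moreover have "(\<lambda>i. w (i + N) + D (?y i)) \<longlonglongrightarrow> v + D x"
    by (intro tendsto_add y' isCont_tendsto_compose[OF D])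
  moreover have "x \<in> edom f"
    using xd eq[OF V(2)] by (auto simp: edom_def)
  ultimately show ?thesis
    using y'(1) unfolding limiting_subdiff_def
    by (simp only: if_True mem_Collect_eq) (intro exI[of _ ?y] exI[of _ "\<lambda>i. w (i + N) + D (?y i)"] conjI; simp)
qed

section \<open>Accumulation points, Kurdyka-Lojasiewicz descent and finite length\<close>

lemma not_accum_point_avoid:
  fixes u :: "nat \<Rightarrow> 'a::metric_space"
  assumes "x \<notin> accum_points u"
  shows "\<exists>e>0. \<forall>\<^sub>F k in sequentially. u k \<notin> ball x e"
proof (rule ccontr)
  assume neg: "\<not> ?thesis"
  have "\<exists>k>m. u k \<in> ball x (inverse (Suc n))" for m n
  proof -
    have "\<not> (\<forall>\<^sub>F k in sequentially. u k \<notin> ball x (inverse (Suc n)))"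
      using neg by (metis inverse_positive_iff_positive of_nat_0_less_iff zero_less_Suc)
    then show ?thesis
      unfolding eventually_at_top_dense by blast
  qed
  then obtain K where K: "\<And>m n. K m n > m" "\<And>m n. u (K m n) \<in> ball x (inverse (Suc n))"
    by metis
  \<comment> \<open>\<open>K m n\<close> is an index beyond \<open>m\<close> at which
    \<open>u\<close> is within \<open>1 / (n + 1)\<close> of \<open>x\<close>; feeding in the
    previous index makes \<open>r\<close> strictly increasing.\<close>
  define r where "r = rec_nat (K 0 0) (\<lambda>n m. K m (Suc n))"
  have "strict_mono r"
    unfolding strict_mono_Suc_iff by (simp add: r_def K)
  moreover have "dist ((u \<circ> r) n) x \<le> inverse (Suc n)" for n
  proof -
    have "\<exists>m. r n = K m n"
      by (cases n) (auto simp: r_def)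
    then obtain m where "r n = K m n" by blast
    then show ?thesis
      using K(2)[where m = m and n = n] by (simp add: dist_commute)
  qed
  then have "(u \<circ> r) \<longlonglongrightarrow> x"
    by (intro metric_tendsto_imp_tendsto[OF LIMSEQ_inverse_real_of_nat])
      (auto simp: dist_real_def)
  ultimately show False
    using assms by (auto simp: accum_points_def)
qed

text \<open>Every other point has a ball that the sequence eventually avoids. These balls and the
  sets \<open>U x\<close> cover the compact closure of the range; in a finite subcover the balls
  become irrelevant for large \<open>k\<close>.\<close>

lemma bounded_eventually_in_finite_cover:
  fixes u :: "nat \<Rightarrow> 'a::heine_borel"
  assumes "bounded (range u)" and U: "\<And>x. x \<in> accum_points u \<Longrightarrow> open (U x) \<and> x \<in> U x"
  obtains F where "finite F" "F \<subseteq> accum_points u" "\<forall>\<^sub>F k in sequentially. u k \<in> (\<Union>x\<in>F. U x)"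
proof -
  let ?A = "accum_points u"
  have "\<forall>x. \<exists>e. x \<notin> ?A \<longrightarrow> e > 0 \<and> (\<forall>\<^sub>F k in sequentially. u k \<notin> ball x e)"
    using not_accum_point_avoid by blast
  from choice[OF this] obtain e where
      e: "\<And>x. x \<notin> ?A \<Longrightarrow> e x > 0 \<and> (\<forall>\<^sub>F k in sequentially. u k \<notin> ball x (e x))"
    by blast
  define W where "W x = (if x \<in> ?A then U x else ball x (e x))" for x
  have W: "open (W x)" "x \<in> W x" for x
    using U[of x] conjunct1[OF e[of x]] by (auto simp: W_def)
  have "compact (closure (range u))"
    using assms(1) by simp
  moreover have "closure (range u) \<subseteq> (\<Union>x\<in>UNIV. W x)"
    using W(2) by blast
  ultimately obtain T where T: "finite T" "closure (range u) \<subseteq> (\<Union>x\<in>T. W x)"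
    by (metis compactE_image[of "closure (range u)" UNIV W] W(1))
  have "\<forall>\<^sub>F k in sequentially. \<forall>x\<in>T - ?A. u k \<notin> ball x (e x)"
  proof (rule eventually_ball_finite)
    show "\<forall>x\<in>T - ?A. \<forall>\<^sub>F k in sequentially. u k \<notin> ball x (e x)"
      using e by blast
  qed (use T(1) in simp)
  then have cov: "\<forall>\<^sub>F k in sequentially. u k \<in> (\<Union>x\<in>T \<inter> ?A. U x)"
  proof eventually_elim
    case (elim k)
    have "u k \<in> closure (range u)"
      by (rule subsetD[OF closure_subset rangeI])
    then obtain x where x: "x \<in> T" "u k \<in> W x"
      using T(2) by blast
    then show ?case
      using elim by (cases "x \<in> ?A") (auto simp: W_def)
  qed
  show thesis
    using T(1) by (intro that[OF _ _ cov]) auto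
qed

text \<open>The arithmetic-geometric mean inequality gives
  \<open>2 * d (Suc k) \<le> d k + c * (p k - p (Suc k))\<close>. Thus \<open>d k + c * p k\<close>
  drops by at least \<open>d (Suc k)\<close> in each step, and it is nonnegative.\<close>

lemma summable_of_telescoping_bound:
  fixes d p :: "nat \<Rightarrow> real"
  assumes d: "\<And>k. 0 \<le> d k" and p: "\<And>k. 0 \<le> p k" and "0 \<le> c"
    and step: "\<And>k. (d (Suc k))\<^sup>2 \<le> c * d k * (p k - p (Suc k))"
    and mono: "\<And>k. p (Suc k) \<le> p k"
  shows "summable d"
proof -
  define Q where "Q k = d k + c * p k" for k
  have amgm: "4 * (a * b) \<le> (a + b)\<^sup>2" for a b :: real
    using zero_le_power2[of "a - b"] unfolding power2_sum power2_diff by linarith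
  have *: "d (Suc k) \<le> Q k - Q (Suc k)" for k
  proof -
    let ?b = "c * (p k - p (Suc k))"
    have "0 \<le> p k - p (Suc k)" using mono[of k] by simp
    then have b: "0 \<le> ?b" by (rule mult_nonneg_nonneg[OF \<open>0 \<le> c\<close>])
    have "(2 * d (Suc k))\<^sup>2 \<le> 4 * (d k * ?b)"
    proof -
      have "(2 * d (Suc k))\<^sup>2 = 4 * (d (Suc k))\<^sup>2"
        by (simp add: power_mult_distrib)
      moreover have "c * d k * (p k - p (Suc k)) = d k * ?b"
        by simp
      ultimately show ?thesis using step[of k] by linarith
    qed
    also have "\<dots> \<le> (d k + ?b)\<^sup>2"
      by (rule amgm)
    finally have "2 * d (Suc k) \<le> d k + ?b"
      using add_nonneg_nonneg[OF d[of k] b] by (rule power2_le_imp_le)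
    then show ?thesis unfolding Q_def right_diff_distrib by linarith
  qed
  have "(\<Sum>k<n. d (Suc k)) \<le> Q 0" for n
  proof -
    have "(\<Sum>k<n. d (Suc k)) \<le> (\<Sum>k<n. Q k - Q (Suc k))"
      using * by (rule sum_mono)
    also have "\<dots> = Q 0 - Q n"
      by (rule sum_lessThan_telescope')
    also have "\<dots> \<le> Q 0"
      using add_nonneg_nonneg[OF d[of n] mult_nonneg_nonneg[OF \<open>0 \<le> c\<close> p[of n]]]
      by (simp add: Q_def)
    finally show ?thesis .
  qed
  then have "summable (\<lambda>k. d (Suc k))"
    using summableI_nonneg_bounded[of "\<lambda>k. d (Suc k)" "Q 0"] d by blast
  then show ?thesis
    by (simp add: summable_Suc_iff)
qed

text \<open>The tangent inequality of convexity for the negated function. The point \<open>t\<close>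
  may be the endpoint 0, at which no derivative is assumed.\<close>

lemma concave_on_tangent:
  fixes \<phi> :: "real \<Rightarrow> real"
  assumes "concave_on {0..<\<eta>} \<phi>" "(\<phi> has_real_derivative d) (at s)" "s \<in> {0<..<\<eta>}" "t \<in> {0..<\<eta>}"
  shows "\<phi> t \<le> \<phi> s + d * (t - s)"
proof -
  have "(\<lambda>x. - \<phi> x) t - (\<lambda>x. - \<phi> x) s \<ge> (- d) * (t - s)"
  proof (rule convex_on_imp_above_tangent)
    show "convex_on {0..<\<eta>} (\<lambda>x. - \<phi> x)"
      using assms(1) unfolding concave_on_def .
    show "((\<lambda>x. - \<phi> x) has_real_derivative - d) (at s within {0..<\<eta>})"
      using assms(2) by (intro DERIV_minus) (rule has_field_derivative_at_within)
    show "connected {0..<\<eta>}"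
      by simp
    show "s \<in> interior {0..<\<eta>}"
      using interior_mono[OF greaterThanLessThan_subseteq_atLeastLessThan_iff[THEN iffD2, of 0 \<eta> 0 \<eta>]] assms(3)
      by (simp only: interior_open[OF open_greaterThanLessThan] subset_iff) simp
    show "t \<in> {0..<\<eta>}"
      by (rule assms(4))
  qed
  then show ?thesis by simp
qed

text \<open>The decrease at a step is measured by its own length, while the subgradient at its
  starting point is bounded by the length of the preceding step. The KL inequality links the two in
  the form required for telescoping.\<close>

lemma KL_descent_summable:
  fixes E :: "'a::euclidean_space \<Rightarrow> ereal" and u :: "nat \<Rightarrow> 'a" and d e :: "nat \<Rightarrow> real"
  assumes val: "\<And>k. k \<ge> 1 \<Longrightarrow> E (u k) = ereal (e k)"
    and d: "\<And>k. 0 \<le> d k" and "0 < a" and "0 \<le> c"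
    and descent: "\<And>k. k \<ge> 1 \<Longrightarrow> e (Suc k) + a * (d k)\<^sup>2 \<le> e k"
    and subgrad: "\<And>k. k \<ge> 1 \<Longrightarrow> \<exists>v\<in>limiting_subdiff E (u (Suc k)). norm v \<le> c * d k"
    and below: "\<And>k. k \<ge> 1 \<Longrightarrow> b \<le> e k"
    and bdd: "bounded (range u)" and cont: "continuous_on (edom E) E"
    and KL: "\<And>x. x \<in> accum_points u \<Longrightarrow> KL_property E x"
  shows "summable d \<or> (\<exists>k\<ge>1. \<forall>j\<ge>k. d j = 0)"
proof -
  let ?A = "accum_points u"
  have dec: "e (Suc k) \<le> e k" if "k \<ge> 1" for k
  proof -
    have "0 \<le> a * (d k)\<^sup>2" using \<open>0 < a\<close> by simp
    with descent[OF that] show ?thesis by linarith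
  qed
  have "decseq (\<lambda>k. e (Suc k))"
    using dec by (simp add: decseq_Suc_iff)
  then obtain l where lim': "(\<lambda>k. e (Suc k)) \<longlonglongrightarrow> l" and le': "\<And>k. l \<le> e (Suc k)"
    using decseq_convergent[of "\<lambda>k. e (Suc k)" b] below by auto
  have lim: "e \<longlonglongrightarrow> l"
    using lim' by (rule LIMSEQ_imp_Suc)
  have le: "l \<le> e k" if "k \<ge> 1" for k
    using le'[of "k - 1"] that by simp
  have mono: "e j \<le> e k" if "1 \<le> k" "k \<le> j" for k j
    using that(2)
  proof (induction rule: dec_induct)
    case (step n)
    then show ?case using dec[of n] that(1) by linarith
  qed simp
  show ?thesis
  \<comment> \<open>A value equal to the limit stays there by monotonicity, so the decrease forces
    zero steps. Otherwise all values lie strictly above \<open>l\<close>, as the KL inequality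
    demands.\<close>
  proof (cases "\<exists>k\<ge>1. e k = l")
    case True
    then obtain k where k: "k \<ge> 1" "e k = l" by blast
    have "d j = 0" if "j \<ge> k" for j
    proof -
      have "j \<ge> 1" using k(1) that by simp
      have "e j \<le> l" using mono[OF k(1) that] k(2) by simp
      moreover have "l \<le> e (Suc j)" by (rule le) simp
      ultimately have "a * (d j)\<^sup>2 \<le> 0"
        using descent[OF \<open>j \<ge> 1\<close>] by linarith
      then show ?thesis
        using \<open>0 < a\<close> by (simp add: mult_le_0_iff)
    qed
    with k(1) show ?thesis by blast
  next
    case False
    then have gt: "l < e k" if "k \<ge> 1" for k
    proof -
      have "e k \<noteq> l" using False that by blast
      with le[OF that] show ?thesis by simp
    qed
    \<comment> \<open>Continuity of \<open>E\<close> on its domain identifies the limit of the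
      values along a subsequence. That \<open>x\<close> is in the domain is part of the KL property,
      and \<open>r n \<ge> 1\<close> is available only eventually.\<close>
    have Ex: "E x = ereal l" if x: "x \<in> ?A" for x
    proof -
      obtain r where r: "strict_mono r" "(u \<circ> r) \<longlonglongrightarrow> x"
        using x by (auto simp: accum_points_def)
      have "x \<in> edom E"
        using KL[OF that] by (simp add: KL_property_def)
      have r1: "\<forall>\<^sub>F n in sequentially. r n \<ge> 1"
        using filterlim_subseq[OF r(1)] by (simp add: filterlim_at_top)
      then have "\<forall>\<^sub>F n in sequentially. (u \<circ> r) n \<in> edom E"
        by eventually_elim (simp add: edom_def val)
      then have "(\<lambda>n. E ((u \<circ> r) n)) \<longlonglongrightarrow> E x"
        by (rule continuous_on_tendsto_compose[OF cont r(2) \<open>x \<in> edom E\<close>])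
      moreover have "(\<lambda>n. E ((u \<circ> r) n)) \<longlonglongrightarrow> ereal l"
      proof (rule Lim_transform_eventually)
        show "(\<lambda>n. ereal (e (r n))) \<longlonglongrightarrow> ereal l"
          using LIMSEQ_subseq_LIMSEQ[OF lim r(1)] by (simp add: o_def)
        show "\<forall>\<^sub>F n in sequentially. ereal (e (r n)) = E ((u \<circ> r) n)"
          using r1 by eventually_elim (simp add: val)
      qed
      ultimately show ?thesis
        by (rule LIMSEQ_unique)
    qed
    \<comment> \<open>The KL data are packed into one predicate so that choice can fix them
      simultaneously for all accumulation points.\<close>
    define P where "P x \<eta> \<phi> \<phi>' U \<longleftrightarrow> \<eta> > 0 \<and> \<phi> 0 = 0 \<and> concave_on {0..<\<eta>} \<phi> \<and>
        (\<forall>s\<in>{0<..<\<eta>}. (\<phi> has_real_derivative \<phi>' s) (at s) \<and> \<phi>' s > 0) \<and> open U \<and> x \<in> U \<and>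
        (\<forall>y\<in>U. E x < E y \<and> E y < E x + ereal \<eta> \<longrightarrow>
           ereal (\<phi>' (real_of_ereal (E y - E x))) * edist_set 0 (limiting_subdiff E y) \<ge> 1)"
      for x \<eta> and \<phi> \<phi>' :: "real \<Rightarrow> real" and U
    have "\<exists>\<eta> \<phi> \<phi>' U. P x \<eta> \<phi> \<phi>' U" if "x \<in> ?A" for x
      using KL[OF that] unfolding KL_property_def P_def by (elim conjE exE) (intro exI conjI; assumption)
    then have "\<forall>x. \<exists>\<eta> \<phi> \<phi>' U. x \<in> ?A \<longrightarrow> P x \<eta> \<phi> \<phi>' U"
      by blast
    then obtain \<eta> \<phi> \<phi>' U where "\<forall>x. x \<in> ?A \<longrightarrow> P x (\<eta> x) (\<phi> x) (\<phi>' x) (U x)"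
      unfolding choice_iff by iprover
    then have P: "P x (\<eta> x) (\<phi> x) (\<phi>' x) (U x)" if "x \<in> ?A" for x
      using that by blast
    have U: "open (U x) \<and> x \<in> U x" if "x \<in> ?A" for x
      using P[OF that] by (simp add: P_def)
    obtain F where F: "finite F" "F \<subseteq> ?A" "\<forall>\<^sub>F k in sequentially. u k \<in> (\<Union>x\<in>F. U x)"
      by (rule bounded_eventually_in_finite_cover[OF bdd U])
    have small: "\<forall>\<^sub>F k in sequentially. \<forall>x\<in>F. e k < l + \<eta> x"
    proof (rule eventually_ball_finite[OF F(1)], rule ballI)
      fix x assume "x \<in> F"
      then have "l < l + \<eta> x" using P[of x] F(2) by (auto simp: P_def)
      then show "\<forall>\<^sub>F k in sequentially. e k < l + \<eta> x"
        by (rule order_tendstoD(2)[OF lim])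
    qed
    have "\<forall>\<^sub>F k in sequentially. k \<ge> 1 \<and> u k \<in> (\<Union>x\<in>F. U x) \<and> (\<forall>x\<in>F. e k < l + \<eta> x)"
      using eventually_ge_at_top[of 1] F(3) small by eventually_elim simp
    then obtain N where N: "\<And>k. k \<ge> N \<Longrightarrow> k \<ge> 1 \<and> u k \<in> (\<Union>x\<in>F. U x) \<and> (\<forall>x\<in>F. e k < l + \<eta> x)"
      unfolding eventually_sequentially by blast
    \<comment> \<open>The neighbourhood containing \<open>u k\<close> may change with
      \<open>k\<close>. Every summand is nonincreasing, so the decrease of the sum dominates that of
      whichever summand is relevant.\<close>
    define p where "p k = (\<Sum>x\<in>F. \<phi> x (e k - l))" for k
    have in_dom: "e k - l \<in> {0<..<\<eta> x}" if "k \<ge> N" "x \<in> F" for k x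
    proof -
      have "e k < l + \<eta> x" "l < e k"
        using N[OF that(1)] gt[of k] that(2) by blast+
      then show ?thesis by simp
    qed
    \<comment> \<open>Taken at \<open>t = e (Suc k) - l\<close> for the decrease of the potential
      and at \<open>t = 0\<close> for its nonnegativity.\<close>
    have tangent: "\<phi> x t \<le> \<phi> x (e k - l) + \<phi>' x (e k - l) * (t - (e k - l))"
      and pos: "\<phi>' x (e k - l) > 0"
      if "k \<ge> N" "x \<in> F" "t \<in> {0..<\<eta> x}" for k x t
    proof -
      have "P x (\<eta> x) (\<phi> x) (\<phi>' x) (U x)"
        using P F(2) that(2) by blast
      then have *: "concave_on {0..<\<eta> x} (\<phi> x)"
        "(\<phi> x has_real_derivative \<phi>' x (e k - l)) (at (e k - l)) \<and> \<phi>' x (e k - l) > 0"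
        using in_dom[OF that(1,2)] unfolding P_def by blast+
      show "\<phi> x t \<le> \<phi> x (e k - l) + \<phi>' x (e k - l) * (t - (e k - l))"
        by (rule concave_on_tangent[OF *(1) conjunct1[OF *(2)] in_dom[OF that(1,2)] that(3)])
      show "\<phi>' x (e k - l) > 0" using *(2) by simp
    qed
    have step: "\<phi>' x (e k - l) * (e k - e (Suc k)) \<le> \<phi> x (e k - l) - \<phi> x (e (Suc k) - l)"
      and pos': "\<phi>' x (e k - l) > 0"
      if "k \<ge> N" "x \<in> F" for k x
    proof -
      have *: "e (Suc k) - l \<in> {0..<\<eta> x}"
        using in_dom[of "Suc k" x] that by simp
      show "\<phi>' x (e k - l) * (e k - e (Suc k)) \<le> \<phi> x (e k - l) - \<phi> x (e (Suc k) - l)"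
        using tangent[OF that *] by (simp add: algebra_simps)
      show "\<phi>' x (e k - l) > 0" by (rule pos[OF that *])
    qed
    have step0: "0 \<le> \<phi> x (e k - l) - \<phi> x (e (Suc k) - l)" if "k \<ge> N" "x \<in> F" for k x
    proof -
      have "0 \<le> \<phi>' x (e k - l) * (e k - e (Suc k))"
        using pos'[OF that] dec[of k] N[OF that(1)] by simp
      then show ?thesis using step[OF that] by linarith
    qed
    have \<phi>0: "0 \<le> \<phi> x (e k - l)" if "k \<ge> N" "x \<in> F" for k x
    proof -
      have "P x (\<eta> x) (\<phi> x) (\<phi>' x) (U x)"
        using P F(2) that(2) by blast
      then have *: "0 \<in> {0..<\<eta> x}" "\<phi> x 0 = 0"
        by (simp_all add: P_def)
      have "0 \<le> \<phi>' x (e k - l) * (e k - l)"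
        using pos[OF that *(1)] in_dom[OF that] by simp
      then show ?thesis
        using tangent[OF that *(1)] *(2) by (simp add: algebra_simps)
    qed
    have main: "(d (Suc j))\<^sup>2 \<le> c / a * d j * (p (Suc j) - p (Suc (Suc j)))" if "j \<ge> N" for j
    proof -
      let ?k = "Suc j"
      have kN: "?k \<ge> N" and j1: "j \<ge> 1" using that N[OF that] by auto
      obtain x where x: "x \<in> F" "u ?k \<in> U x"
        using N[OF kN] by blast
      have xA: "x \<in> ?A" using x(1) F(2) by blast
      obtain v where v: "v \<in> limiting_subdiff E (u ?k)" "norm v \<le> c * d j"
        using subgrad[OF j1] by blast
      let ?f = "\<phi>' x (e ?k - l)"
      have "E (u ?k) = ereal (e ?k)" by (rule val) simp
      moreover have "e ?k < l + \<eta> x" "l < e ?k"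
        using N[OF kN] x(1) gt[of ?k] by auto
      moreover have "E x < E (u ?k) \<and> E (u ?k) < E x + ereal (\<eta> x) \<longrightarrow>
          1 \<le> ereal (\<phi>' x (real_of_ereal (E (u ?k) - E x))) * edist_set 0 (limiting_subdiff E (u ?k))"
        using P[OF xA] x(2) unfolding P_def by blast
      ultimately have "1 \<le> ereal ?f * edist_set 0 (limiting_subdiff E (u ?k))"
        using Ex[OF xA] by simp
      \<comment> \<open>The distance is an infimum, so the single subgradient \<open>v\<close>
        bounds it from above.\<close>
      also have "\<dots> \<le> ereal ?f * ereal (norm v)"
      proof (rule ereal_mult_left_mono)
        show "edist_set 0 (limiting_subdiff E (u ?k)) \<le> ereal (norm v)"
          unfolding edist_set_def using INF_lower[OF v(1), of "\<lambda>w. ereal (norm (0 - w))"] by simp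
        show "0 \<le> ereal ?f" using pos'[OF kN x(1)] by simp
      qed
      finally have "1 \<le> ?f * norm v" by simp
      also have "\<dots> \<le> ?f * (c * d j)"
        using pos'[OF kN x(1)] v(2) by (intro mult_left_mono) auto
      finally have f1: "1 \<le> ?f * (c * d j)" .
      have de: "0 \<le> e ?k - e (Suc ?k)" using dec[of ?k] by simp
      \<comment> \<open>The factor 1 is displayed so that the KL bound \<open>f1\<close> can replace
        it by \<open>?f * (c * d j)\<close>.\<close>
      have "a * (d ?k)\<^sup>2 \<le> 1 * (e ?k - e (Suc ?k))"
        using descent[of ?k] by simp
      also have "\<dots> \<le> (?f * (c * d j)) * (e ?k - e (Suc ?k))"
        by (rule mult_right_mono[OF f1 de])
      also have "\<dots> = (c * d j) * (?f * (e ?k - e (Suc ?k)))"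
        by (simp only: mult_ac)
      also have "\<dots> \<le> (c * d j) * (p ?k - p (Suc ?k))"
      proof (rule mult_left_mono)
        have "?f * (e ?k - e (Suc ?k)) \<le> \<phi> x (e ?k - l) - \<phi> x (e (Suc ?k) - l)"
          by (rule step[OF kN x(1)])
        also have "\<dots> \<le> (\<Sum>y\<in>F. \<phi> y (e ?k - l) - \<phi> y (e (Suc ?k) - l))"
          using member_le_sum[OF x(1), of "\<lambda>y. \<phi> y (e ?k - l) - \<phi> y (e (Suc ?k) - l)"] step0[OF kN] F(1)
          by simp
        also have "\<dots> = p ?k - p (Suc ?k)"
          by (simp add: p_def sum_subtractf)
        finally show "?f * (e ?k - e (Suc ?k)) \<le> p ?k - p (Suc ?k)" .
        show "0 \<le> c * d j" using \<open>0 \<le> c\<close> d by simp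
      qed
      finally show ?thesis
        using \<open>0 < a\<close> by (simp add: pos_le_divide_eq mult.commute)
    qed
    \<comment> \<open>The potential runs one index ahead of \<open>d\<close>, because
      \<open>main\<close> compares \<open>d j\<close> with the decrease of \<open>p\<close> from
      \<open>Suc j\<close> on.\<close>
    have "summable (\<lambda>i. d (i + N))"
    proof (rule summable_of_telescoping_bound)
      show "0 \<le> p (Suc (i + N))" for i
        unfolding p_def by (intro sum_nonneg \<phi>0) auto
      show "p (Suc (Suc i + N)) \<le> p (Suc (i + N))" for i
        unfolding p_def by (intro sum_mono) (use step0[of "Suc (i + N)"] in simp)
      show "(d (Suc i + N))\<^sup>2 \<le> c / a * d (i + N) * (p (Suc (i + N)) - p (Suc (Suc i + N)))" for i
        using main[of "i + N"] by simp
      show "0 \<le> c / a" using \<open>0 \<le> c\<close> \<open>0 < a\<close> by simp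
    qed (rule d)
    then have "summable d"
      by (simp add: summable_iff_shift)
    then show ?thesis ..
  qed
qed

section \<open>The gap between the objective and its surrogate\<close>

lemma limiting_subdiff_bregman_residual:
  fixes \<rho> :: "'a::euclidean_space \<Rightarrow> 'b::euclidean_space" and H :: "'b \<Rightarrow> real"
  assumes S: "open S" "\<rho> x \<in> S"
    and eq: "\<And>y. \<rho> y \<in> S \<Longrightarrow> E y = f y + ereal (- (H (\<rho> y) - c - inner p (\<rho> y - z)))"
    and fin: "\<And>y. \<rho> y \<in> S \<Longrightarrow> f y \<noteq> - \<infinity>"
    and H: "\<And>y. y \<in> S \<Longrightarrow> GDERIV H y :> F y" and F: "continuous_on S F"
    and \<rho>': "\<And>y. (\<rho> has_derivative blinfun_apply (\<rho>' y)) (at y)" and cont: "continuous_on UNIV \<rho>'"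
    and crit: "0 \<in> limiting_subdiff f x"
  shows "\<exists>v\<in>limiting_subdiff E x. norm v \<le> norm (\<rho>' x) * norm (F (\<rho> x) - p)"
proof -
  \<comment> \<open>The adjoint of \<open>\<rho>' y\<close> applied to
    \<open>p - F (\<rho> y)\<close>, in coordinates. By the chain rule it is the gradient of the
    smooth correction in \<open>eq\<close>, so adding \<open>D x\<close> to the critical subgradient
    0 of \<open>f\<close> gives one of \<open>E\<close>.\<close>
  define D where "D y = (\<Sum>b\<in>Basis. - inner (blinfun_apply (\<rho>' y) b) (F (\<rho> y) - p) *\<^sub>R b)" for y
  have D: "inner d (D y) = - inner (blinfun_apply (\<rho>' y) d) (F (\<rho> y) - p)" for d y
  proof -
    have "linear (\<lambda>d. - inner (blinfun_apply (\<rho>' y) d) (F (\<rho> y) - p))"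
      by (intro linearI) (auto simp: blinfun.add_right blinfun.scaleR_right inner_add_left)
    from linear_functional_eq_inner[OF this, of d] show ?thesis
      by (simp add: D_def)
  qed
  have "isCont \<rho> y" for y
    using \<rho>' by (rule has_derivative_continuous)
  then have \<rho>: "continuous_on UNIV \<rho>"
    by (simp add: continuous_at_imp_continuous_on)
  have V: "open (\<rho> -` S)"
    using S(1) \<rho> by (simp add: open_vimage)
  have "0 + D x \<in> limiting_subdiff E x"
  proof (rule limiting_subdiff_add_gderiv[OF V])
    show "x \<in> \<rho> -` S" using S(2) by simp
    show "E y = f y + ereal (- (H (\<rho> y) - c - inner p (\<rho> y - z)))" if "y \<in> \<rho> -` S" for y
      using eq that by simp
    show "f y \<noteq> - \<infinity>" if "y \<in> \<rho> -` S" for y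
      using fin that by simp
    show "GDERIV (\<lambda>y. - (H (\<rho> y) - c - inner p (\<rho> y - z))) y :> D y" if "y \<in> \<rho> -` S" for y
    proof -
      have "(H has_derivative (\<lambda>d. inner d (F (\<rho> y)))) (at (\<rho> y))"
        using H[of "\<rho> y"] that by (simp add: gderiv_def)
      then have "((\<lambda>y. H (\<rho> y)) has_derivative (\<lambda>d. inner (blinfun_apply (\<rho>' y) d) (F (\<rho> y)))) (at y)"
        using diff_chain_at[OF \<rho>'[of y]] by (simp add: o_def)
      moreover have "((\<lambda>y. inner p (\<rho> y - z)) has_derivative (\<lambda>d. inner p (blinfun_apply (\<rho>' y) d))) (at y)"
        by (rule derivative_eq_intros \<rho>' refl | simp)+
      ultimately have "((\<lambda>y. - (H (\<rho> y) - c - inner p (\<rho> y - z))) has_derivative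
          (\<lambda>d. - (inner (blinfun_apply (\<rho>' y) d) (F (\<rho> y)) - 0 - inner p (blinfun_apply (\<rho>' y) d)))) (at y)"
        by (intro has_derivative_minus has_derivative_diff has_derivative_const)
      then show ?thesis
        unfolding gderiv_def D by (simp add: inner_diff_right inner_commute[of p])
    qed
    have "continuous_on (\<rho> -` S) D"
      unfolding D_def
    proof (intro continuous_intros)
      show "continuous_on (\<rho> -` S) \<rho>'"
        using cont continuous_on_subset by blast
      show "continuous_on (\<rho> -` S) (\<lambda>y. F (\<rho> y))"
        by (rule continuous_on_compose2[OF F continuous_on_subset[OF \<rho>]]) auto
    qed
    then show "isCont D x"
      using V S(2) by (simp add: continuous_on_eq_continuous_at)
  qed (rule crit)
  moreover have "norm (D x) \<le> norm (\<rho>' x) * norm (F (\<rho> x) - p)"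
  proof (cases "D x = 0")
    case False
    \<comment> \<open>Testing \<open>D x\<close> against itself yields the operator norm bound for
      the adjoint after cancelling one factor \<open>norm (D x)\<close>.\<close>
    have "norm (D x) * norm (D x) = inner (D x) (D x)"
      by (simp add: power2_norm_eq_inner flip: power2_eq_square)
    also have "\<dots> = - inner (blinfun_apply (\<rho>' x) (D x)) (F (\<rho> x) - p)"
      by (rule D)
    also have "\<dots> \<le> norm (blinfun_apply (\<rho>' x) (D x)) * norm (F (\<rho> x) - p)"
      using Cauchy_Schwarz_ineq2 abs_le_D2 by blast
    also have "\<dots> \<le> (norm (\<rho>' x) * norm (D x)) * norm (F (\<rho> x) - p)"
      by (intro mult_right_mono norm_blinfun) simp
    finally have "norm (D x) * norm (D x) \<le> (norm (\<rho>' x) * norm (F (\<rho> x) - p)) * norm (D x)"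
      by (simp only: mult_ac)
    then show ?thesis
      using False by simp
  qed simp
  ultimately show ?thesis by auto
qed

text \<open>The subtracted quantity is the Bregman distance of \<open>H\<close>. It is real, so the
  identity holds as a sum even where \<open>R y\<close>, and with it both functions, is
  infinite.\<close>

lemma objective_eq_surrogate:
  fixes h G :: "'b::real_inner \<Rightarrow> ereal" and R :: "'a \<Rightarrow> ereal" and \<tau> :: real
  assumes "proper_fun h" "proper_fun G" "edom h \<subseteq> edom G"
    and S: "\<rho> w \<in> interior (edom h)" "\<rho> y \<in> interior (edom h)"
  defines "H \<equiv> \<lambda>x. 1 / \<tau> * real_of_ereal (h x) - real_of_ereal (G x)"
  shows "objective G R \<rho> y = surrogate h G R \<rho> \<tau> w y +
      ereal (- (H (\<rho> y) - H (\<rho> w) - inner ((1 / \<tau>) *\<^sub>R egrad h (\<rho> w) - egrad G (\<rho> w)) (\<rho> y - \<rho> w)))"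
proof -
  have dom: "\<rho> w \<in> edom h" "\<rho> y \<in> edom h" "\<rho> w \<in> edom G" "\<rho> y \<in> edom G"
    using S assms(3) interior_subset by blast+
  obtain hw hy gw gy where *: "h (\<rho> w) = ereal hw" "h (\<rho> y) = ereal hy"
      "G (\<rho> w) = ereal gw" "G (\<rho> y) = ereal gy"
    using edom_real[OF assms(1)] edom_real[OF assms(2)] dom by metis
  show ?thesis
    using S by (cases "R y")
      (simp_all add: objective_def surrogate_def bregman_def H_def * inner_diff_left algebra_simps)
qed

section \<open>Convergence of the Bregman majorization iteration\<close>

theorem theorem1:
  fixes C :: "(real ^ 'm) set"
    and h G :: "real ^ 'm \<Rightarrow> ereal"
    and R :: "real ^ 'n \<Rightarrow> ereal"
    and \<rho> :: "real ^ 'n \<Rightarrow> real ^ 'm"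
    and L \<tau> :: real
    and u :: "nat \<Rightarrow> real ^ 'n"
    and z :: "nat \<Rightarrow> real ^ 'm"
  assumes z_def: "\<And>k. z k = \<rho> (u k)"
    (* basic assumptions *)
    and C: "closed C" "convex C" "interior C \<noteq> {}"
    and h: "proper_fun h" "lsc_fun h" "econvex h" "essentially_smooth h" "closure (edom h) = C"
    and G: "proper_fun G" "lsc_fun G" "edom h \<subseteq> edom G"
      "\<forall>x\<in>interior (edom h). (\<lambda>y. real_of_ereal (G y)) differentiable (at x)"
    and R: "proper_fun R" "lsc_fun R" "edom R \<inter> \<rho> -` interior (edom h) \<noteq> {}"
    and \<rho>: "continuous_on UNIV \<rho>"
    and step: "\<tau> > 0"
    and start: "\<rho> (u 0) \<in> interior (edom h)"
    (* Assumptions A *)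
    and E_bounded_below: "\<exists>b::real. \<forall>v. ereal b \<le> objective G R \<rho> v"
    and E_coercive: "(objective G R \<rho> \<longlongrightarrow> \<infinity>) at_infinity"
    and L: "L > 0"
      "convex_on (interior (edom h)) (\<lambda>x. L * real_of_ereal (h x) - real_of_ereal (G x))"
    and descent: "\<And>k. surrogate h G R \<rho> \<tau> (u k) (u (Suc k)) \<le> surrogate h G R \<rho> \<tau> (u k) (u k)"
    and feasible: "\<And>k. \<rho> (u (Suc k)) \<in> interior (edom h)"
    (* Assumptions B *)
    and E_continuous: "continuous_on (edom (objective G R \<rho>)) (objective G R \<rho>)"
    and KL: "\<forall>x\<in>accum_points u. KL_property (objective G R \<rho>) x"
    and h_strongly_convex:
      "\<exists>\<sigma>>0. strongly_convex_on (interior (edom h)) \<sigma> (\<lambda>x. real_of_ereal (h x))"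
    and \<rho>_C1: "continuously_differentiable \<rho>"
    and grad_lipschitz:
      "locally_lipschitz_on (interior (edom h)) (\<lambda>x. (1 / \<tau>) *\<^sub>R egrad h x - egrad G x)"
    and Z: "closure (z ` {1..}) \<subseteq> interior (edom h)"
    and critical: "\<And>k. 0 \<in> limiting_subdiff (surrogate h G R \<rho> \<tau> (u k)) (u (Suc k))"
    and step_bound: "\<tau> < 1 / L"
  shows "((\<lambda>k. norm (z (Suc k) - z k)) summable_on {1..} \<and>
          (\<exists>z_lim \<in> interior (edom h). z \<longlonglongrightarrow> z_lim))
       \<or> terminates_finitely (objective G R \<rho>) \<rho> u"
proof -
  let ?S = "interior (edom h)" and ?E = "objective G R \<rho>"
  define H where "H x = 1 / \<tau> * real_of_ereal (h x) - real_of_ereal (G x)" for x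
  define F where "F x = (1 / \<tau>) *\<^sub>R egrad h x - egrad G x" for x
  define d where "d k = norm (z (Suc k) - z k)" for k
  define e where "e k = real_of_ereal (?E (u k))" for k
  have zS: "z k \<in> ?S" for k
    using start feasible by (cases k) (auto simp: z_def)
  have HF: "GDERIV H x :> F x" if x: "x \<in> ?S" for x
  proof -
    have "GDERIV (\<lambda>y. real_of_ereal (h y)) x :> egrad h x"
      using essentially_smooth_gderiv[OF h(1,3,4) x] gderiv_egrad by blast
    then have 1: "GDERIV (\<lambda>y. 1 / \<tau> * real_of_ereal (h y)) x :> (1 / \<tau>) *\<^sub>R egrad h x"
      unfolding gderiv_def inner_scaleR_right by (rule has_derivative_mult_right)
    have "GDERIV (\<lambda>y. real_of_ereal (G y)) x :> egrad G x"
      using differentiable_imp_gderiv[OF bspec[OF G(4) x]] gderiv_egrad by blast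
    from GDERIV_diff[OF 1 this] show ?thesis
      unfolding H_def F_def .
  qed
  obtain \<sigma> where \<sigma>: "\<sigma> > 0" "strongly_convex_on ?S \<sigma> (\<lambda>x. real_of_ereal (h x))"
    using h_strongly_convex by blast
  have \<tau>L: "0 < 1 / \<tau> - L"
    using step_bound step L(1) by (simp add: field_simps)
  \<comment> \<open>Half the strong convexity modulus of \<open>H\<close>, as it appears in the
    tangent inequality; positive because \<open>\<tau> < 1 / L\<close>.\<close>
  define a where "a = (1 / \<tau> - L) * \<sigma> / 2"
  have "a > 0" using \<tau>L \<sigma>(1) by (simp add: a_def)
  have Hstrong: "strongly_convex_on ?S ((1 / \<tau> - L) * \<sigma>) H"
    unfolding strongly_convex_on_def
  proof (intro conjI ballI allI impI)
    show "convex ?S"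
      using \<sigma>(2) by (simp add: strongly_convex_on_def)
    fix x y and s t :: real
    assume *: "x \<in> ?S" "y \<in> ?S" "0 \<le> s" "0 \<le> t" "s + t = 1"
    let ?w = "s *\<^sub>R x + t *\<^sub>R y" and ?h = "\<lambda>x. real_of_ereal (h x)" and ?G = "\<lambda>x. real_of_ereal (G x)"
    have "?h ?w \<le> s * ?h x + t * ?h y - \<sigma> / 2 * s * t * (norm (x - y))\<^sup>2"
      using \<sigma>(2) * unfolding strongly_convex_on_def by blast
    from mult_left_mono[OF this less_imp_le[OF \<tau>L]]
    have 1: "(1 / \<tau> - L) * ?h ?w
        \<le> (1 / \<tau> - L) * (s * ?h x + t * ?h y - \<sigma> / 2 * s * t * (norm (x - y))\<^sup>2)" .
    have 2: "L * ?h ?w - ?G ?w \<le> s * (L * ?h x - ?G x) + t * (L * ?h y - ?G y)"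
      using L(2) * unfolding convex_on_def by blast
    \<comment> \<open>A positive multiple of the strongly convex \<open>h\<close> plus the convex
      \<open>L * h - G\<close>.\<close>
    have split: "H v = (1 / \<tau> - L) * ?h v + (L * ?h v - ?G v)" for v
      by (simp add: H_def left_diff_distrib)
    have "H ?w \<le> (1 / \<tau> - L) * (s * ?h x + t * ?h y - \<sigma> / 2 * s * t * (norm (x - y))\<^sup>2)
        + (s * (L * ?h x - ?G x) + t * (L * ?h y - ?G y))"
      unfolding split[of ?w] using 1 2 by (rule add_mono)
    also have "\<dots> = s * H x + t * H y - (1 / \<tau> - L) * \<sigma> / 2 * s * t * (norm (x - y))\<^sup>2"
      unfolding split[of x] split[of y] by (simp add: ring_distribs mult_ac)
    finally show "H ?w \<le> s * H x + t * H y - (1 / \<tau> - L) * \<sigma> / 2 * s * t * (norm (x - y))\<^sup>2" .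
  qed
  have gap: "?E y = surrogate h G R \<rho> \<tau> (u k) y
      + ereal (- (H (\<rho> y) - H (z k) - inner (F (z k)) (\<rho> y - z k)))" if "\<rho> y \<in> ?S" for y k
    using objective_eq_surrogate[where R = R and \<tau> = \<tau>, OF h(1) G(1,3) zS[of k, unfolded z_def] that]
    unfolding H_def F_def z_def .
  obtain b :: real where b: "\<And>v. ereal b \<le> ?E v"
    using E_bounded_below by blast
  \<comment> \<open>Criticality places \<open>u k\<close> in the domain of the preceding surrogate.
    The starting point has no predecessor and \<open>R (u 0)\<close> may be infinite, hence the
    restriction to positive indices.\<close>
  have val: "?E (u k) = ereal (e k)" if "k \<ge> 1" for k
  proof -
    obtain j where j: "k = Suc j" using \<open>k \<ge> 1\<close> by (cases k) auto
    have "u k \<in> edom (surrogate h G R \<rho> \<tau> (u j))"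
      using critical[of j] unfolding j limiting_subdiff_def by (auto split: if_splits)
    then have "?E (u k) < \<infinity>"
      using gap[of "u k" j] zS[of k] by (auto simp: edom_def z_def)
    moreover have "ereal b \<le> ?E (u k)" by (rule b)
    ultimately show ?thesis
      unfolding e_def by (cases "?E (u k)") auto
  qed
  have descent': "e (Suc k) + a * (d k)\<^sup>2 \<le> e k" if "k \<ge> 1" for k
  proof -
    let ?s = "surrogate h G R \<rho> \<tau> (u k) (u (Suc k))"
    let ?D = "H (z (Suc k)) - H (z k) - inner (F (z k)) (z (Suc k) - z k)"
    have le: "?s \<le> ereal (e k)"
      using descent[of k] surrogate_self[OF h(1), where \<rho> = \<rho> and w = "u k"] zS[of k] val[OF that]
      by (simp add: z_def)
    have "?E (u (Suc k)) = ?s + ereal (- ?D)"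
      using gap[of "u (Suc k)" k] zS[of "Suc k"] by (simp add: z_def)
    then have "ereal (e (Suc k)) = ?s + ereal (- ?D)"
      using val[of "Suc k"] by simp
    with le have "e (Suc k) + ?D \<le> e k"
      by (cases ?s) auto
    moreover have "a * (d k)\<^sup>2 \<le> ?D"
      using strongly_convex_on_gderiv[OF Hstrong zS[of "Suc k"] zS[of k] HF[OF zS]]
      unfolding a_def d_def by linarith
    ultimately show ?thesis by linarith
  qed
  have le_e1: "e k \<le> e 1" if "k \<ge> 1" for k
    using that
  proof (induction rule: dec_induct)
    case (step n)
    have "0 \<le> a * (d n)\<^sup>2" using \<open>a > 0\<close> by simp
    then show ?case using descent'[of n] step by linarith
  qed simp
  have "\<forall>\<^sub>F v in at_infinity. ereal (e 1) < ?E v"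
    using E_coercive unfolding tendsto_PInfty by blast
  then obtain B where B: "\<And>v. B \<le> norm v \<Longrightarrow> ereal (e 1) < ?E v"
    unfolding eventually_at_infinity by blast
  have bdd: "bounded (range u)"
    unfolding bounded_iff
  proof (intro exI ballI)
    fix v assume "v \<in> range u"
    then obtain k where k: "v = u k" by blast
    \<comment> \<open>Coercivity confines all iterates whose objective is at most
      \<open>e 1\<close>; \<open>u 0\<close> is not among these in general and is added by
      hand.\<close>
    show "norm v \<le> max B (norm (u 0))"
    proof (cases "k = 0")
      case False
      then have "\<not> ereal (e 1) < ?E (u k)"
        using le_e1[of k] val[of k] by simp
      then have "\<not> B \<le> norm (u k)" using B by blast
      then show ?thesis using k by simp
    qed (simp add: k)
  qed
  obtain \<rho>' where \<rho>': "\<And>y. (\<rho> has_derivative blinfun_apply (\<rho>' y)) (at y)" "continuous_on UNIV \<rho>'"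
    using \<rho>_C1 unfolding continuously_differentiable_def by blast
  \<comment> \<open>One compact set provides both the uniform bound \<open>M\<close> on the
    derivative of \<open>\<rho>\<close> and the boundedness of the images
    \<open>z k\<close>.\<close>
  have cpt: "compact (closure (range u))"
    using bdd by simp
  have "bounded (\<rho>' ` closure (range u))"
    by (intro compact_imp_bounded compact_continuous_image cpt continuous_on_subset[OF \<rho>'(2)]) simp
  then obtain M where M: "\<And>y. y \<in> closure (range u) \<Longrightarrow> norm (\<rho>' y) \<le> M"
    unfolding bounded_iff by blast
  have "bounded (\<rho> ` closure (range u))"
    by (intro compact_imp_bounded compact_continuous_image cpt continuous_on_subset[OF \<rho>]) simp
  then have "bounded (z ` {1..})"
  proof (rule bounded_subset)
    show "z ` {1..} \<subseteq> \<rho> ` closure (range u)"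
      using closure_subset[of "range u"] by (auto simp: z_def)
  qed
  then have cptZ: "compact (closure (z ` {1..}))"
    by simp
  \<comment> \<open>\<open>local_lipschitz\<close> carries a time parameter, here frozen at 0, and
    uses closed balls, hence the halved radius.\<close>
  have loc: "local_lipschitz {0::real} ?S (\<lambda>_. F)"
  proof (rule local_lipschitzI)
    fix t :: real and x assume "x \<in> ?S"
    then obtain r K where r: "r > 0" "K-lipschitz_on (ball x r \<inter> ?S) F"
      using grad_lipschitz unfolding locally_lipschitz_on_def F_def by blast
    have "K-lipschitz_on (cball x (r / 2) \<inter> ?S) F"
      by (rule lipschitz_on_subset[OF r(2)]) (use r(1) in auto)
    then show "\<exists>r>0. \<exists>K. \<forall>t\<in>cball t r \<inter> {0}. K-lipschitz_on (cball x r \<inter> ?S) F"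
      using r(1) by (intro exI[of _ "r / 2"]) auto
  qed
  have F: "continuous_on ?S F"
    using local_lipschitz_continuous_on[OF loc, of 0] by simp
  \<comment> \<open>The closure of the images is compact and inside the open set where
    \<open>F\<close> is locally Lipschitz, so a single constant serves all steps.\<close>
  obtain K where "K-lipschitz_on (closure (z ` {1..})) F"
    using local_lipschitz_compact_implies_lipschitz[OF local_lipschitz_subset[OF loc order_refl Z] cptZ]
    by auto
  note K = lipschitz_on_nonneg[OF this] lipschitz_onD[OF this]
  have M0: "0 \<le> M"
    using M[of "u 0"] closure_subset[of "range u"] order_trans[OF norm_ge_zero] by blast
  have subgrad: "\<exists>v\<in>limiting_subdiff ?E (u (Suc k)). norm v \<le> M * K * d k" if "k \<ge> 1" for k
  proof -
    have "\<exists>v\<in>limiting_subdiff ?E (u (Suc k)).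
        norm v \<le> norm (\<rho>' (u (Suc k))) * norm (F (\<rho> (u (Suc k))) - F (z k))"
    proof (rule limiting_subdiff_bregman_residual[where S = ?S and H = H and F = F and \<rho> = \<rho>
          and f = "surrogate h G R \<rho> \<tau> (u k)" and c = "H (z k)" and z = "z k"])
      show "\<rho> (u (Suc k)) \<in> ?S" by (rule feasible)
      \<comment> \<open>By \<open>gap\<close> the value minus infinity would pass to the objective,
        which is bounded below by \<open>b\<close>.\<close>
      show "surrogate h G R \<rho> \<tau> (u k) y \<noteq> - \<infinity>" if "\<rho> y \<in> ?S" for y
        using gap[OF that, of k] b[of y] by (cases "surrogate h G R \<rho> \<tau> (u k) y") auto
    qed (use gap HF F \<rho>' critical in \<open>simp_all\<close>)
    then obtain v where v: "v \<in> limiting_subdiff ?E (u (Suc k))"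
        "norm v \<le> norm (\<rho>' (u (Suc k))) * norm (F (z (Suc k)) - F (z k))"
      by (auto simp: z_def)
    \<comment> \<open>The set starts at index 1, so \<open>k \<ge> 1\<close> is what admits
      \<open>z k\<close>.\<close>
    have "z (Suc k) \<in> closure (z ` {1..})" "z k \<in> closure (z ` {1..})"
      using that closure_subset[of "z ` {1..}"] by auto
    then have "norm (F (z (Suc k)) - F (z k)) \<le> K * d k"
      using K(2) by (simp add: dist_norm d_def)
    moreover have "norm (\<rho>' (u (Suc k))) \<le> M"
      using closure_subset[of "range u"] by (intro M) blast
    ultimately have "norm (\<rho>' (u (Suc k))) * norm (F (z (Suc k)) - F (z k)) \<le> M * (K * d k)"
      using M0 by (intro mult_mono) auto
    with v(2) have "norm v \<le> M * K * d k"
      unfolding mult.assoc by (rule order_trans)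
    with v(1) show ?thesis by blast
  qed
  have "summable d \<or> (\<exists>k\<ge>1. \<forall>j\<ge>k. d j = 0)"
  proof (rule KL_descent_summable[where E = ?E and u = u and e = e and a = a and b = b and c = "M * K"])
    show "b \<le> e k" if "k \<ge> 1" for k
      using b[of "u k"] val[OF that] by simp
    show "0 \<le> M * K" using M0 K(1) by simp
    show "0 \<le> d k" for k by (simp add: d_def)
  qed (use val \<open>a > 0\<close> descent' subgrad bdd E_continuous KL in auto)
  then show ?thesis
  proof
    assume sum: "summable d"
    have "d summable_on {1..}"
      by (rule summable_on_subset_banach[OF summable_nonneg_imp_summable_on[OF sum]])
        (auto simp: d_def)
    moreover have "\<exists>z_lim\<in>?S. z \<longlonglongrightarrow> z_lim"
    proof -
      have "summable (\<lambda>k. z (Suc k) - z k)"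
        using sum unfolding d_def by (rule summable_norm_cancel)
      then obtain s where "(\<lambda>n. \<Sum>k<n. z (Suc k) - z k) \<longlonglongrightarrow> s"
        using summable_LIMSEQ by blast
      then have "(\<lambda>n. (z n - z 0) + z 0) \<longlonglongrightarrow> s + z 0"
        unfolding sum_lessThan_telescope by (intro tendsto_add tendsto_const)
      then have lim: "z \<longlonglongrightarrow> s + z 0" by simp
      have "\<forall>\<^sub>F k in sequentially. z k \<in> closure (z ` {1..})"
        using eventually_ge_at_top[of 1]
        by eventually_elim (use closure_subset[of "z ` {1..}"] in auto)
      \<comment> \<open>Closedness keeps the limit away from the boundary of the domain, since this
        closure lies in the interior.\<close>
      then have "s + z 0 \<in> closure (z ` {1..})"
        by (rule Lim_in_closed_set[OF closed_closure _ trivial_limit_sequentially lim])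
      with lim Z show ?thesis by blast
    qed
    ultimately show ?thesis
      unfolding d_def by blast
  next
    assume "\<exists>k\<ge>1. \<forall>j\<ge>k. d j = 0"
    then obtain k where k: "k \<ge> 1" "\<And>j. j \<ge> k \<Longrightarrow> d j = 0" by blast
    \<comment> \<open>The bound \<open>M * K * d k\<close> vanishes, but it concerns the endpoint of
      step \<open>k\<close>; hence the stopping index is \<open>Suc k\<close>.\<close>
    have "0 \<in> limiting_subdiff ?E (u (Suc k))"
      using subgrad[OF k(1)] k(2)[of k] by simp
    moreover have "z j = z (Suc k)" if "j \<ge> Suc k" for j
      using that
    proof (induction rule: dec_induct)
      case (step n)
      then show ?case using k(2)[of n] by (simp add: d_def)
    qed simp
    ultimately show ?thesis
      unfolding terminates_finitely_def z_def by blast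
  qed
qed

end
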